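(* Let $1\le m\le n$, let $\Sigma_s\subset\mathbb{R}^m$ be an $m$-dimensional polytope, let $A$ be an $n\times m$ real matrix with linearly independent columns, let $\mathbf{x}_0\in\mathbb{R}^n$, and let $\Sigma=\{\mathbf{x}_0+A\mathbf{s}:\mathbf{s}\in\Sigma_s\}\subset\mathbb{R}^n$ be the image of $\Sigma_s$ under the affine map $\mathbf{s}\mapsto\mathbf{x}_0+A\mathbf{s}$. Then $$ \frac{|\Sigma|}{|\Sigma_s|} = \sqrt{\det(A^\top A)}, $$ and for each flat face $\sigma\subset\partial\Sigma$, the image of a flat face $\sigma_s\subset\partial\Sigma_s$ with unit outward normal $\mathbf{n}_s\in\mathbb{R}^m$, the vector $$ \mathbf{n}_x = A (A^\top A)^{-1} \mathbf{n}_s\, \frac{|\sigma_s|}{|\sigma|}\, \frac{|\Sigma|}{|\Sigma_s|} $$ is a unit vector that is outward normal to $\Sigma$ on $\sigma$.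
   Context: A polytope in $\mathbb{R}^m$ here is a compact set that is the closure of its nonempty interior and whose boundary consists of finitely many flat $(m-1)$-dimensional faces. $|\Sigma_s|$ and $|\Sigma|$ denote $m$-dimensional measures, and $|\sigma_s|$, $|\sigma|$ denote $(m-1)$-dimensional measures. $\partial\Sigma$ is the boundary of $\Sigma$ relative to its affine hull $\mathbf{x}_0+\operatorname{range}(A)$, i.e. the image of $\partial\Sigma_s$. That $\mathbf{n}_x$ is outward normal to $\Sigma$ on $\sigma$ means that $\mathbf{n}_x$ lies in the column space of $A$, is orthogonal to the face $\sigma$, and points out of $\Sigma$ across $\sigma$. *)

theory Defs
  imports "HOL-Analysis.Analysis"
begin

(* The polytopes considered here need not be convex, so the library constants
   polytope and face_of (both about convex sets) do not apply.

   A flat face is a compact flat piece of the boundary, contained in a hyperplane.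
   That it is (m-1)-dimensional is understood as for the polytope itself: it spans a
   hyperplane and is the closure of its interior relative to that hyperplane, so it
   has no lower-dimensional parts.  For m = 1 the flat faces are the boundary points. *)
definition flat_face :: "'a::euclidean_space set \<Rightarrow> 'a set \<Rightarrow> bool" where
  "flat_face F S \<longleftrightarrow>
     compact F \<and> F \<subseteq> frontier S \<and>
     aff_dim F = int DIM('a) - 1 \<and> closure (rel_interior F) = F"

definition flat_faced_polytope :: "'a::euclidean_space set \<Rightarrow> bool" where
  "flat_faced_polytope S \<longleftrightarrow>
     compact S \<and> interior S \<noteq> {} \<and> closure (interior S) = S \<and>
     (\<exists>\<F>. finite \<F> \<and> (\<forall>F\<in>\<F>. flat_face F S) \<and> \<Union>\<F> = frontier S)"

(* S may have empty interior in the ambient space; its boundary is taken relative to its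
   affine hull.  The crossing condition is imposed at the relative interior points of F
   near which F is the whole boundary of S.  These are dense in a flat face of a polytope,
   but another part of a non-convex S may touch F from outside at the remaining points. *)
definition outward_normal :: "'a::euclidean_space set \<Rightarrow> 'a set \<Rightarrow> 'a \<Rightarrow> bool" where
  "outward_normal S F v \<longleftrightarrow>
     (\<forall>x\<in>F. \<forall>y\<in>F. orthogonal v (x - y)) \<and>
     (\<forall>x \<in> rel_interior F - closure (rel_frontier S - F).
        \<exists>e>0. \<forall>t. 0 < t \<and> t < e \<longrightarrow> x + t *\<^sub>R v \<notin> S \<and> x - t *\<^sub>R v \<in> S)"

definition flat_map :: "nat \<Rightarrow> 'a::euclidean_space \<Rightarrow> (nat \<Rightarrow> 'a) \<Rightarrow> (nat \<Rightarrow> real) \<Rightarrow> 'a" where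
  "flat_map k p b c = p + (\<Sum>i<k. c i *\<^sub>R b i)"

definition flat_chart :: "nat \<Rightarrow> 'a::euclidean_space set \<Rightarrow> 'a \<Rightarrow> (nat \<Rightarrow> 'a) \<Rightarrow> bool" where
  "flat_chart k S p b \<longleftrightarrow>
     (\<forall>i<k. \<forall>j<k. b i \<bullet> b j = (if i = j then 1 else 0)) \<and> S \<subseteq> range (flat_map k p b)"

(* k-dimensional Lebesgue measure of a Borel set S contained in a k-dimensional affine
   subspace: the Lebesgue measure of S in Cartesian coordinates on that subspace.  The
   value does not depend on the chosen coordinates, as they differ by an isometry.  For
   k = 0 the product measure is a unit point mass, so a point has measure 1. *)
definition flat_measure :: "nat \<Rightarrow> 'a::euclidean_space set \<Rightarrow> real" where
  "flat_measure k S =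
     (let (p, b) = (SOME (p, b). flat_chart k S p b);
          M = (\<Pi>\<^sub>M i\<in>{..<k}. (lborel :: real measure))
      in measure M {c \<in> space M. flat_map k p b c \<in> S})"

(* columns A is a set and forgets repetitions, hence the injectivity requirement. *)
definition independent_columns :: "real^'m^'n \<Rightarrow> bool" where
  "independent_columns A \<longleftrightarrow> inj (\<lambda>j. column j A) \<and> independent (columns A)"

end

theory Submission
  imports Defs
begin

text \<open>
  Write \<open>f s = x\<^sub>0 + A s\<close> and \<open>G = A\<^sup>T A\<close>.  Everything rests on two computations of volume.

  The first is the scaling law.  Choose an orthonormal basis \<open>b\<close> of the column space of \<open>A\<close> and
  let \<open>B\<close> be the square matrix of \<open>A\<close> with respect to it.  In the coordinates given by \<open>b\<close> the
  map \<open>f\<close> is \<open>B\<close> followed by a translation, so it multiplies \<open>m\<close>-dimensional measure by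
  \<open>\<bar>det B\<bar>\<close>; and \<open>B\<^sup>T B = G\<close> because \<open>b\<close> is orthonormal, so that \<open>\<bar>det B\<bar> = sqrt (det G)\<close>.  This
  is \<open>chart_measure_affine_image\<close>.

  The second compares the faces by means of prisms, which avoids determinants in dimension
  \<open>m - 1\<close>.  Let \<open>F\<close> be a face with unit normal \<open>n\<close>.  The prism \<open>F + [0, 1] n\<close> has volume \<open>|F|\<close>.
  Its image under \<open>f\<close> is the prism over \<open>f F\<close> with the edge \<open>A n\<close>, whose volume is \<open>|f F|\<close> times the
  height, which is the component of \<open>A n\<close> along the normal of \<open>f F\<close> in the column space of \<open>A\<close>.
  That normal is \<open>c = A G\<^bsup>-1\<^esup> n\<close>: indeed \<open>A u \<bullet> c = u \<bullet> n\<close> for all \<open>u\<close>, which vanishes along \<open>F\<close>.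
  The same identity gives the height \<open>(A n \<bullet> c) / norm c = 1 / norm c\<close>.  The scaling law now says
  \<open>|f F| / norm c = sqrt (det G) |F|\<close>, which is \<open>flat_measure_face_image\<close>, and this is exactly the
  assertion that the vector in the theorem is \<open>c / norm c\<close>.

  It remains to see that \<open>c\<close> points outwards.  Pulled back by \<open>f\<close>, the direction \<open>c\<close> becomes
  \<open>w = G\<^bsup>-1\<^esup> n\<close>, which need not be parallel to \<open>n\<close> but satisfies \<open>n \<bullet> w = norm c ^ 2 > 0\<close>.  Near a
  point at which the face is the whole boundary, the two open half balls cut off by the
  hyperplane of the face are connected and miss the boundary; hence one lies inside the polytope
  and the other outside, and every direction on the same side as \<open>n\<close> crosses the face outwards
  (\<open>crosses_halfspaces\<close>).
\<close>

section \<open>Orthonormal charts\<close>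

definition orthonormal :: "nat \<Rightarrow> (nat \<Rightarrow> 'a::real_inner) \<Rightarrow> bool" where
  "orthonormal k b \<longleftrightarrow> (\<forall>i<k. \<forall>j<k. b i \<bullet> b j = (if i = j then 1 else 0))"

lemma flat_chart_iff: "flat_chart k S p b \<longleftrightarrow> orthonormal k b \<and> S \<subseteq> range (flat_map k p b)"
  by (simp add: flat_chart_def orthonormal_def)

lemma orthonormal_inj_on: "orthonormal k b \<Longrightarrow> inj_on b {..<k}"
  by (rule inj_onI) (metis lessThan_iff orthonormal_def zero_neq_one)

lemma orthonormal_card: "orthonormal k b \<Longrightarrow> card (b ` {..<k}) = k"
  by (simp add: card_image orthonormal_inj_on)

lemma orthonormal_independent:
  fixes b :: "nat \<Rightarrow> 'a::euclidean_space"
  assumes "orthonormal k b"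
  shows "independent (b ` {..<k})"
proof (rule pairwise_orthogonal_independent)
  show "pairwise orthogonal (b ` {..<k})"
    using assms by (auto simp: pairwise_def orthogonal_def orthonormal_def)
  show "0 \<notin> b ` {..<k}"
    using assms by (auto simp: orthonormal_def) (metis inner_zero_left zero_neq_one)
qed

lemma orthonormal_Suc:
  assumes "orthonormal k b" "norm v = 1" "\<And>i. i < k \<Longrightarrow> b i \<bullet> v = 0"
  shows "orthonormal (Suc k) (b(k := v))"
  using assms unfolding orthonormal_def
  by (auto simp: less_Suc_eq inner_commute dot_square_norm)

lemma orthonormal_spans:
  fixes b :: "nat \<Rightarrow> 'a::euclidean_space"
  assumes "orthonormal k b" "subspace V" "dim V = k" "\<And>i. i < k \<Longrightarrow> b i \<in> V"
  shows "span (b ` {..<k}) = V"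
proof (rule subspace_dim_equal)
  show "span (b ` {..<k}) \<subseteq> V"
    using assms by (intro span_minimal) auto
  show "dim V \<le> dim (span (b ` {..<k}))"
    using assms by (simp add: dim_eq_card_independent orthonormal_independent orthonormal_card)
qed (use assms in auto)

lemma range_flat_map:
  assumes "orthonormal k b"
  shows "range (flat_map k p b) = (+) p ` span (b ` {..<k})"
proof
  show "range (flat_map k p b) \<subseteq> (+) p ` span (b ` {..<k})"
    unfolding flat_map_def by (auto intro!: imageI span_sum span_scale intro: span_base)
  have "\<exists>c. y = (\<Sum>i<k. c i *\<^sub>R b i)" if "y \<in> span (b ` {..<k})" for y
  proof -
    from that obtain u where "y = (\<Sum>v\<in>b ` {..<k}. u v *\<^sub>R v)"
      by (auto simp: span_finite)
    also have "\<dots> = (\<Sum>i<k. u (b i) *\<^sub>R b i)"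
      by (simp add: sum.reindex orthonormal_inj_on assms)
    finally show ?thesis by (rule exI[of _ "\<lambda>i. u (b i)"])
  qed
  then show "(+) p ` span (b ` {..<k}) \<subseteq> range (flat_map k p b)"
    unfolding flat_map_def by fast
qed

lemma flat_map_coordinate:
  assumes "orthonormal k b" "i < k"
  shows "b i \<bullet> (flat_map k p b c - p) = c i"
proof -
  have "b i \<bullet> (flat_map k p b c - p) = (\<Sum>j<k. c j * (b i \<bullet> b j))"
    by (simp add: flat_map_def inner_sum_right)
  also have "\<dots> = (\<Sum>j<k. if j = i then c j else 0)"
    using assms by (intro sum.cong) (auto simp: orthonormal_def)
  finally show ?thesis using assms by simp
qed

lemma flat_map_eq_iff:
  assumes "orthonormal k b" "y \<in> range (flat_map k p b)"
  shows "flat_map k p b c = y \<longleftrightarrow> (\<forall>i<k. c i = b i \<bullet> (y - p))"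
proof -
  from assms(2) obtain d where d: "y = flat_map k p b d" by blast
  then have "(\<forall>i<k. c i = b i \<bullet> (y - p)) \<longleftrightarrow> (\<forall>i<k. c i = d i)"
    using flat_map_coordinate[OF assms(1)] by auto
  also have "\<dots> \<longleftrightarrow> flat_map k p b c = y"
  proof
    assume "\<forall>i<k. c i = d i" then show "flat_map k p b c = y" by (simp add: d flat_map_def)
  next
    assume *: "flat_map k p b c = y"
    show "\<forall>i<k. c i = d i"
      using flat_map_coordinate[OF assms(1), of _ p c] flat_map_coordinate[OF assms(1), of _ p d] * d by metis
  qed
  finally show ?thesis by simp
qed

text \<open>
  The measure in a given chart, without the choice made in \<^const>\<open>flat_measure\<close>.
\<close>

definition chart_measure :: "nat \<Rightarrow> 'a::euclidean_space \<Rightarrow> (nat \<Rightarrow> 'a) \<Rightarrow> 'a set \<Rightarrow> real" where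
  "chart_measure k p b S =
     measure (\<Pi>\<^sub>M i\<in>{..<k}. lborel) {c \<in> space (\<Pi>\<^sub>M i\<in>{..<k}. lborel). flat_map k p b c \<in> S}"

text \<open>
  The measure of a flat set is defined through an arbitrary chart.  When the set spans an affine
  subspace of dimension exactly \<open>k\<close>, a dimension count shows that the chart must parametrise
  that subspace, so its basis vectors lie in the direction space.
\<close>

lemma flat_measure_chart:
  fixes S :: "'a::euclidean_space set"
  assumes hull: "affine hull S = (+) q ` V" and V: "subspace V" "dim V = k"
  obtains p b where "orthonormal k b" "range (flat_map k p b) = affine hull S"
    "\<And>i. i < k \<Longrightarrow> b i \<in> V" "flat_measure k S = chart_measure k p b S"
proof -
  have "\<exists>p b. flat_chart k S p b"
  proof -
    obtain B where B: "B \<subseteq> V" "pairwise orthogonal B" "\<And>x. x \<in> B \<Longrightarrow> norm x = 1"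
        "independent B" "card B = dim V" "span B = V"
      using orthonormal_basis_subspace[OF V(1)] by metis
    have "finite B" using B(4) by (rule independent_imp_finite)
    then obtain b where b: "bij_betw b {..<k} B"
      using ex_bij_betw_nat_finite[of B] V B(5) by (auto simp: lessThan_atLeast0)
    have o: "orthonormal k b"
      unfolding orthonormal_def
    proof safe
      fix i j assume ij: "i < k" "j < k"
      show "b i \<bullet> b j = (if i = j then 1 else 0)"
      proof (cases "i = j")
        case True
        then show ?thesis using B(3)[of "b i"] b ij by (auto simp: dot_square_norm bij_betw_def)
      next
        case False
        then have "b i \<noteq> b j" "b i \<in> B" "b j \<in> B" using b ij by (auto simp: bij_betw_def inj_on_def)
        then show ?thesis using B(2) False by (auto simp: pairwise_def orthogonal_def)
      qed
    qed
    have "S \<subseteq> range (flat_map k q b)"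
      using hull_subset[of S affine] hull b B(6) by (simp add: range_flat_map[OF o] bij_betw_def)
    with o show ?thesis unfolding flat_chart_iff by blast
  qed
  then have "\<exists>pb. (\<lambda>(p, b). flat_chart k S p b) pb" by auto
  then have "(\<lambda>(p, b). flat_chart k S p b) (SOME (p, b). flat_chart k S p b)"
    by (rule someI_ex)
  then obtain p b where pb: "(SOME (p, b). flat_chart k S p b) = (p, b)" and "flat_chart k S p b"
    by (auto split: prod.splits)
  then have o: "orthonormal k b" and sub: "S \<subseteq> (+) p ` span (b ` {..<k})"
    by (auto simp: flat_chart_iff range_flat_map)
  have "affine ((+) p ` span (b ` {..<k}))"
    using affine_translation[of "span (b ` {..<k})" p] by (simp add: subspace_imp_affine)
  then have "affine hull S \<subseteq> (+) p ` span (b ` {..<k})"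
    by (intro hull_minimal sub)
  then have incl: "(+) q ` V \<subseteq> (+) p ` span (b ` {..<k})" using hull by simp
  have VS: "V \<subseteq> span (b ` {..<k})"
  proof
    fix v assume "v \<in> V"
    then have "q + v \<in> (+) p ` span (b ` {..<k})" "q + 0 \<in> (+) p ` span (b ` {..<k})"
      using incl subspace_0[OF V(1)] by blast+
    then obtain r s where "r \<in> span (b ` {..<k})" "s \<in> span (b ` {..<k})" "q + v = p + r" "q = p + s"
      by auto
    moreover from this have "v = r - s" by (simp add: algebra_simps)
    ultimately show "v \<in> span (b ` {..<k})" by (simp add: span_diff)
  qed
  have dimspan: "dim (span (b ` {..<k})) = k"
    using o by (simp add: dim_eq_card_independent orthonormal_independent orthonormal_card)
  then have eq: "V = span (b ` {..<k})"
    using VS V by (intro subspace_dim_equal) auto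
  have "q + 0 \<in> (+) p ` V"
    using incl subspace_0[OF V(1)] eq by blast
  then obtain s where s: "s \<in> V" "q = p + s" by auto
  have "(+) q ` V = (+) p ` V"
  proof
    show "(+) q ` V \<subseteq> (+) p ` V" using incl eq by simp
    show "(+) p ` V \<subseteq> (+) q ` V"
    proof
      fix y assume "y \<in> (+) p ` V"
      then obtain v where "v \<in> V" "y = p + v" by auto
      then have "y = q + (v - s)" "v - s \<in> V" using s V(1) by (auto simp: subspace_diff)
      then show "y \<in> (+) q ` V" by blast
    qed
  qed
  then have "range (flat_map k p b) = affine hull S"
    using hull eq by (simp add: range_flat_map o)
  moreover have "b i \<in> V" if "i < k" for i
    using that eq by (auto intro: span_base)
  moreover have "flat_measure k S = chart_measure k p b S"
    by (simp add: flat_measure_def chart_measure_def pb Let_def)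
  ultimately show ?thesis using that o by blast
qed

lemma flat_map_measurable [measurable]:
  "flat_map k p b \<in> borel_measurable (\<Pi>\<^sub>M i\<in>{..<k}. lborel)"
  unfolding flat_map_def by measurable

section \<open>Volume of a prism\<close>

lemma PiM_lborel_translate:
  assumes "finite I" and Q[measurable]: "Measurable.pred (\<Pi>\<^sub>M i\<in>I. lborel) Q"
  shows "emeasure (\<Pi>\<^sub>M i\<in>I. lborel) {x \<in> space (\<Pi>\<^sub>M i\<in>I. lborel). Q (\<lambda>i\<in>I. x i + d i)}
       = emeasure (\<Pi>\<^sub>M i\<in>I. (lborel :: real measure)) {x \<in> space (\<Pi>\<^sub>M i\<in>I. lborel). Q x}"
proof -
  interpret product_sigma_finite "\<lambda>_. lborel :: real measure" by standard
  let ?M = "\<Pi>\<^sub>M i\<in>I. (lborel :: real measure)"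
  let ?T = "\<lambda>x. \<lambda>i\<in>I. x i + d i :: real"
  have T[measurable]: "?T \<in> measurable ?M ?M" by measurable
  have "distr ?M ?M ?T = ?M"
  proof (rule PiM_eqI)
    fix A assume A: "\<And>i. i \<in> I \<Longrightarrow> A i \<in> sets (lborel :: real measure)"
    have shift: "emeasure lborel ((\<lambda>x. x + d i) -` A i) = emeasure lborel (A i)" if "i \<in> I" for i
    proof -
      have plus: "(+) (d i) = (\<lambda>x. x + d i)" by (simp add: fun_eq_iff add.commute)
      have "emeasure lborel (A i) = emeasure (distr lborel borel ((+) (d i))) (A i)"
        by (simp add: lborel_distr_plus)
      also have "\<dots> = emeasure lborel ((\<lambda>x. x + d i) -` A i)"
        using A[OF that] by (subst emeasure_distr) (simp_all add: plus)
      finally show ?thesis by simp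
    qed
    have "?T -` Pi\<^sub>E I A \<inter> space ?M = Pi\<^sub>E I (\<lambda>i. (\<lambda>x. x + d i) -` A i)"
      by (auto simp: space_PiM PiE_iff)
    moreover have "(\<lambda>x. x + d i) -` A i \<in> sets lborel" if "i \<in> I" for i
      using measurable_sets[of "\<lambda>x. x + d i" lborel lborel "A i"] A[OF that] by simp
    ultimately show "emeasure (distr ?M ?M ?T) (Pi\<^sub>E I A) = (\<Prod>i\<in>I. emeasure lborel (A i))"
      using A assms(1) shift by (subst emeasure_distr) (auto simp: emeasure_PiM intro!: sets_PiM_I_finite)
  qed (use assms in auto)
  then have "emeasure ?M {x \<in> space ?M. Q x} = emeasure (distr ?M ?M ?T) {x \<in> space ?M. Q x}" by simp
  also have "\<dots> = emeasure ?M (?T -` {x \<in> space ?M. Q x} \<inter> space ?M)"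
    by (rule emeasure_distr) measurable
  also have "?T -` {x \<in> space ?M. Q x} \<inter> space ?M = {x \<in> space ?M. Q (?T x)}"
    using measurable_space[OF T] by auto
  finally show ?thesis by simp
qed

definition prism :: "'a::real_vector \<Rightarrow> 'a set \<Rightarrow> 'a set" where
  "prism v S = (\<lambda>(x, t). x + t *\<^sub>R v) ` (S \<times> {0..1})"

lemma compact_prism:
  fixes S :: "'a::real_normed_vector set"
  assumes "compact S" shows "compact (prism v S)"
  unfolding prism_def case_prod_unfold
  by (intro compact_continuous_image compact_Times assms compact_Icc continuous_on_add
      continuous_on_scaleR continuous_on_fst continuous_on_snd continuous_on_const continuous_on_id)

text \<open>
  Volume is base times height.  In coordinates the slice of the prism at height \<open>c k\<close> is a
  translate of the base, shifted by the tangential part of the edge \<open>v\<close>; Fubini's theorem and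
  translation invariance then give the product of the base with the length \<open>h\<close> of the range of
  heights.
\<close>

lemma chart_measure_prism:
  fixes S :: "'a::euclidean_space set"
  assumes o: "orthonormal (Suc k) b" and S: "S \<subseteq> range (flat_map k p b)" "compact S"
    and v: "v \<in> span (b ` {..<Suc k})" and h: "b k \<bullet> v = h" "h > 0"
  shows "chart_measure (Suc k) p b (prism v S) = h * chart_measure k p b S"
proof -
  interpret product_sigma_finite "\<lambda>_. lborel :: real measure" by standard
  let ?M = "\<lambda>k. \<Pi>\<^sub>M i\<in>{..<k}. (lborel :: real measure)"
  have o': "orthonormal k b" using o by (auto simp: orthonormal_def)
  have "0 + v \<in> range (flat_map (Suc k) 0 b)"
    using v by (auto simp: range_flat_map[OF o])
  then obtain a where "v = flat_map (Suc k) 0 b a" by auto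
  then have va: "v = (\<Sum>i<k. a i *\<^sub>R b i) + a k *\<^sub>R b k" by (simp add: flat_map_def)
  have ak: "a k = h"
    using h flat_map_coordinate[OF o, of k 0 a] \<open>v = flat_map (Suc k) 0 b a\<close> by simp
  \<comment> \<open>A point of the prism has height \<open>c k = t * h\<close> over the base, where \<open>t\<close> is its position along
    the edge; going back along the edge by \<open>t = c k / h\<close> leads to the base.\<close>
  have mem: "flat_map (Suc k) p b c \<in> prism v S \<longleftrightarrow>
      c k \<in> {0..h} \<and> flat_map k p b (\<lambda>i. c i - c k / h * a i) \<in> S" for c
  proof
    assume "flat_map (Suc k) p b c \<in> prism v S"
    then obtain x t where x: "x \<in> S" "0 \<le> t" "t \<le> 1" and e: "flat_map (Suc k) p b c = x + t *\<^sub>R v"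
      by (auto simp: prism_def)
    obtain d where d: "x = flat_map k p b d" using S(1) x(1) by auto
    have "x + t *\<^sub>R v = flat_map (Suc k) p b (\<lambda>i. if i = k then t * h else d i + t * a i)"
      unfolding d va ak flat_map_def
      by (simp add: sum.distrib scaleR_sum_right scaleR_add_left scaleR_add_right)
    then have "c i = (if i = k then t * h else d i + t * a i)" if "i < Suc k" for i
      using e flat_map_coordinate[OF o that, of p c]
        flat_map_coordinate[OF o that, of p "\<lambda>i. if i = k then t * h else d i + t * a i"] by simp
    then have ck: "c k = t * h" and ci: "\<And>i. i < k \<Longrightarrow> c i = d i + t * a i" by auto
    have "flat_map k p b (\<lambda>i. c i - c k / h * a i) = x"
      using h(2) by (simp add: d flat_map_def ck ci)
    then show "c k \<in> {0..h} \<and> flat_map k p b (\<lambda>i. c i - c k / h * a i) \<in> S"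
      using x h(2) ck by (auto simp: mult_le_cancel_right1)
  next
    assume *: "c k \<in> {0..h} \<and> flat_map k p b (\<lambda>i. c i - c k / h * a i) \<in> S"
    have "flat_map (Suc k) p b c = flat_map k p b (\<lambda>i. c i - c k / h * a i) + (c k / h) *\<^sub>R v"
      using h(2) unfolding va ak flat_map_def
      by (simp add: scaleR_diff_left scaleR_add_right sum_subtractf scaleR_sum_right)
    moreover have "c k / h \<in> {0..1}" using * h(2) by auto
    ultimately show "flat_map (Suc k) p b c \<in> prism v S"
      using * by (auto simp: prism_def)
  qed
  have [measurable]: "S \<in> sets borel" "prism v S \<in> sets borel"
    using S(2) by (auto intro: borel_compact compact_prism)
  let ?P = "{c \<in> space (?M (Suc k)). flat_map (Suc k) p b c \<in> prism v S}"
  let ?Q = "{c \<in> space (?M k). flat_map k p b c \<in> S}"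
  have ins: "?M (Suc k) = Pi\<^sub>M (insert k {..<k}) (\<lambda>_. lborel)" by (simp add: lessThan_Suc)
  have P[measurable]: "?P \<in> sets (?M (Suc k))" by measurable
  have "emeasure (?M (Suc k)) ?P = (\<integral>\<^sup>+ c. indicator ?P c \<partial>?M (Suc k))"
    by simp
  also have "\<dots> = (\<integral>\<^sup>+ y. (\<integral>\<^sup>+ x. indicator ?P (x(k := y)) \<partial>?M k) \<partial>lborel)"
    unfolding ins using P by (subst product_nn_integral_insert_rev) (auto simp: lessThan_Suc)
  also have "\<dots> = (\<integral>\<^sup>+ y. emeasure (?M k) ?Q * indicator {0..h} y \<partial>lborel)"
  proof (rule nn_integral_cong)
    fix y :: real
    let ?T = "\<lambda>x. \<lambda>i\<in>{..<k}. x i + (- (y / h * a i)) :: real"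
    have "(\<integral>\<^sup>+ x. indicator ?P (x(k := y)) \<partial>?M k) =
        (\<integral>\<^sup>+ x. indicator {x \<in> space (?M k). flat_map k p b (?T x) \<in> S} x * indicator {0..h} y \<partial>?M k)"
    proof (rule nn_integral_cong)
      fix x assume x: "x \<in> space (?M k)"
      have "x(k := y) \<in> space (?M (Suc k))"
        using x by (auto simp: space_PiM PiE_def extensional_def)
      moreover have "flat_map k p b (\<lambda>i. (x(k := y)) i - (x(k := y)) k / h * a i) = flat_map k p b (?T x)"
        by (simp add: flat_map_def)
      ultimately show "indicator ?P (x(k := y)) =
          (indicator {x \<in> space (?M k). flat_map k p b (?T x) \<in> S} x * indicator {0..h} y :: ennreal)"
        using x by (auto simp: mem indicator_def)
    qed
    also have "\<dots> = emeasure (?M k) {x \<in> space (?M k). flat_map k p b (?T x) \<in> S} * indicator {0..h} y"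
      by (subst nn_integral_multc) auto
    also have "emeasure (?M k) {x \<in> space (?M k). flat_map k p b (?T x) \<in> S} = emeasure (?M k) ?Q"
      by (rule PiM_lborel_translate) auto
    finally show "(\<integral>\<^sup>+ x. indicator ?P (x(k := y)) \<partial>?M k) = emeasure (?M k) ?Q * indicator {0..h} y" .
  qed
  also have "\<dots> = emeasure (?M k) ?Q * ennreal h"
    using h(2) by (subst nn_integral_cmult_indicator) auto
  finally show ?thesis
    using h(2) by (simp add: chart_measure_def measure_def enn2real_mult)
qed

section \<open>The determinant as the scaling factor of volume\<close>

lemma borel_measurable_vec_PiM:
  fixes e :: "'m::finite \<Rightarrow> 'i"
  assumes "\<And>j. e j \<in> I"
  shows "(\<lambda>c. \<chi> j. c (e j)) \<in> borel_measurable (\<Pi>\<^sub>M i\<in>I. (lborel :: real measure))"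
proof -
  have "(\<lambda>c. c (e j)) \<in> borel_measurable (\<Pi>\<^sub>M i\<in>I. (lborel :: real measure))" for j
    using measurable_component_singleton[OF assms, of j "\<lambda>_. lborel :: real measure"] by simp
  then have "(\<lambda>c. (\<Sum>j\<in>UNIV. c (e j) *\<^sub>R axis j (1::real))) \<in>
      borel_measurable (\<Pi>\<^sub>M i\<in>I. (lborel :: real measure))"
    by (intro borel_measurable_sum borel_measurable_scaleR borel_measurable_const)
  also have "(\<lambda>c. (\<Sum>j\<in>UNIV. c (e j) *\<^sub>R axis j (1::real))) = (\<lambda>c. \<chi> j. c (e j))"
    by (simp add: fun_eq_iff vec_eq_iff axis_def if_distrib cong: if_cong)
  finally show ?thesis .
qed

text \<open>
  The enumeration \<open>e\<close> of the coordinates is arbitrary.  With values in an initial segment of the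
  natural numbers it identifies Cartesian space with the coordinates of a chart; with \<open>e\<close> a
  permutation of the index type it says that permuting coordinates preserves volume.
\<close>

lemma lborel_eq_distr_PiM:
  fixes e :: "'m::finite \<Rightarrow> 'i"
  assumes e: "bij_betw e UNIV I"
  shows "(lborel :: (real^'m) measure) =
     distr (\<Pi>\<^sub>M i\<in>I. lborel) borel (\<lambda>c. \<chi> j. c (e j))"
proof (rule lborel_eqI)
  interpret product_sigma_finite "\<lambda>_. lborel :: real measure" by standard
  have fin: "finite I" using e by (metis bij_betw_finite finite)
  let ?M = "\<Pi>\<^sub>M i\<in>I. (lborel :: real measure)"
  have ej: "e j \<in> I" for j using e by (auto simp: bij_betw_def)
  note T = borel_measurable_vec_PiM[of e "I"]
  fix l u :: "real^'m" assume lu: "\<And>b. b \<in> Basis \<Longrightarrow> l \<bullet> b \<le> u \<bullet> b"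
  have le: "l $ j \<le> u $ j" for j
    using lu[of "axis j 1"] by (simp add: inner_axis)
  define f where "f = the_inv_into UNIV e"
  have fe: "f (e j) = j" for j
    using e by (simp add: f_def bij_betw_def the_inv_into_f_f)
  have "(\<lambda>c. \<chi> j. c (e j)) -` box l u \<inter> space ?M = Pi\<^sub>E I (\<lambda>i. {l $ f i<..<u $ f i})"
  proof (intro set_eqI iffI)
    fix c assume c: "c \<in> (\<lambda>c. \<chi> j. c (e j)) -` box l u \<inter> space ?M"
    have "c i \<in> {l $ f i<..<u $ f i}" if "i \<in> I" for i
    proof -
      have "i \<in> range e" using that e by (simp add: bij_betw_def)
      then obtain j where "i = e j" by blast
      then show ?thesis using c by (simp add: mem_box_cart fe)
    qed
    then show "c \<in> Pi\<^sub>E I (\<lambda>i. {l $ f i<..<u $ f i})"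
      using c by (auto simp: space_PiM PiE_iff)
  next
    fix c assume c: "c \<in> Pi\<^sub>E I (\<lambda>i. {l $ f i<..<u $ f i})"
    have "c (e j) \<in> {l $ j<..<u $ j}" for j
      using PiE_mem[OF c, of "e j"] ej[of j] fe[of j] by simp
    then show "c \<in> (\<lambda>c. \<chi> j. c (e j)) -` box l u \<inter> space ?M"
      using c by (auto simp: space_PiM PiE_iff mem_box_cart)
  qed
  then have "emeasure (distr ?M borel (\<lambda>c. \<chi> j. c (e j))) (box l u)
      = (\<Prod>i\<in>I. emeasure lborel {l $ f i<..<u $ f i})"
    using T ej fin by (simp add: emeasure_distr emeasure_PiM)
  also have "\<dots> = (\<Prod>j\<in>UNIV. emeasure lborel {l $ f (e j)<..<u $ f (e j)})"
    using prod.reindex_bij_betw[OF e, of "\<lambda>i. emeasure lborel {l $ f i<..<u $ f i}"] by simp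
  also have "\<dots> = (\<Prod>j\<in>UNIV. ennreal (u $ j - l $ j))"
    using le by (simp add: fe)
  also have "\<dots> = ennreal (\<Prod>j\<in>UNIV. u $ j - l $ j)"
    using le by (simp add: prod_ennreal)
  also have "(\<Prod>j\<in>UNIV. u $ j - l $ j) = (\<Prod>b\<in>Basis. (u - l) \<bullet> b)"
  proof -
    have B: "(Basis :: (real^'m) set) = (\<lambda>j. axis j 1) ` UNIV"
      by (auto simp: Basis_vec_def)
    have inj: "inj (\<lambda>j. axis j (1::real) :: real^'m)"
      by (auto simp: inj_on_def axis_eq_axis)
    have "(\<Prod>b\<in>Basis. (u - l) \<bullet> b) = (\<Prod>j\<in>UNIV. (u - l) \<bullet> axis j 1)"
      unfolding B by (subst prod.reindex[OF inj]) simp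
    then show ?thesis by (simp add: inner_axis)
  qed
  finally show "emeasure (distr ?M borel (\<lambda>c. \<chi> j. c (e j))) (box l u) = (\<Prod>b\<in>Basis. (u - l) \<bullet> b)" .
qed simp

text \<open>
  A linear map is a composition of elementary ones.  Transpositions of coordinates and shears
  preserve Lebesgue measure, by symmetry of the product measure and by translation invariance on
  the lines parallel to an axis; their determinants have absolute value 1.
\<close>

lemma measure_linear_image_cart:
  fixes f :: "real^'m \<Rightarrow> real^'m"
  assumes "linear f" "compact S"
  shows "measure lebesgue (f ` S) = \<bar>det (matrix f)\<bar> * measure lebesgue S"
proof -
  let ?M = "\<Pi>\<^sub>M i\<in>(UNIV :: 'm set). (lborel :: real measure)"
  have comp: "compact (h ` T)" if "linear h" "compact T" for h :: "real^'m \<Rightarrow> real^'m" and T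
    using that by (intro compact_continuous_image linear_continuous_on) (auto simp: linear_conv_bounded_linear)
  have leb: "measure lebesgue T = measure lborel T" if "compact T" for T :: "(real^'m) set"
    using that by (simp add: measure_completion borel_compact)
  \<comment> \<open>The image of \<open>T\<close> is a set whose preimage is \<open>T\<close>, so it suffices to know the image measure.\<close>
  have preserve: "measure lebesgue (h ` T) = measure lebesgue T"
    if h: "linear h" "inj h" "distr lborel borel h = lborel" and T: "compact T"
    for h :: "real^'m \<Rightarrow> real^'m" and T
  proof -
    have m: "h \<in> borel_measurable borel"
      using h(1) by (intro borel_measurable_continuous_onI linear_continuous_on) (auto simp: linear_conv_bounded_linear)
    have "measure lborel (h ` T) = measure (distr lborel borel h) (h ` T)" using h(3) by simp
    also have "\<dots> = measure lborel (h -` (h ` T) \<inter> space lborel)"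
      using m comp[OF h(1) T] by (intro measure_distr) (auto intro: borel_compact)
    also have "h -` (h ` T) \<inter> space lborel = T" using h(2) by (simp add: inj_vimage_image_eq)
    finally show ?thesis using T comp[OF h(1) T] by (simp add: leb)
  qed
  have "\<forall>S. compact S \<longrightarrow> measure lebesgue (f ` S) = \<bar>det (matrix f)\<bar> * measure lebesgue S"
  proof (rule induct_linear_elementary[OF assms(1)]; intro allI impI)
    fix f g :: "real^'m \<Rightarrow> real^'m" and S :: "(real^'m) set"
    assume lin: "linear f" "linear g" and S: "compact S"
      and f: "\<forall>S. compact S \<longrightarrow> measure lebesgue (f ` S) = \<bar>det (matrix f)\<bar> * measure lebesgue S"
      and g: "\<forall>S. compact S \<longrightarrow> measure lebesgue (g ` S) = \<bar>det (matrix g)\<bar> * measure lebesgue S"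
    have "measure lebesgue (f ` g ` S) = \<bar>det (matrix f)\<bar> * (\<bar>det (matrix g)\<bar> * measure lebesgue S)"
      using f g S comp[OF lin(2) S] by simp
    then show "measure lebesgue ((f \<circ> g) ` S) = \<bar>det (matrix (f \<circ> g))\<bar> * measure lebesgue S"
      by (simp add: matrix_compose lin det_mul abs_mult image_comp)
  next
    fix f :: "real^'m \<Rightarrow> real^'m" and i and S :: "(real^'m) set"
    assume f: "linear f" "\<And>x. f x $ i = 0"
    have "row i (matrix f) = 0" using f(2) by (simp add: row_def matrix_def vec_eq_iff)
    then have "det (matrix f) = 0" by (rule det_zero_row)
    moreover have "negligible (f ` S)"
      by (rule negligible_subset[OF negligible_standard_hyperplane_cart[of i]]) (use f(2) in auto)
    ultimately show "measure lebesgue (f ` S) = \<bar>det (matrix f)\<bar> * measure lebesgue S"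
      by (simp add: negligible_imp_measure0)
  next
    fix c :: "'m \<Rightarrow> real" and S :: "(real^'m) set" assume S: "compact S"
    have "det (matrix (\<lambda>x::real^'m. \<chi> i. c i * x $ i)) = prod c UNIV"
      by (subst det_diagonal) (auto simp: matrix_def axis_def)
    then show "measure lebesgue ((\<lambda>x. \<chi> i. c i * x $ i) ` S)
        = \<bar>det (matrix (\<lambda>x::real^'m. \<chi> i. c i * x $ i))\<bar> * measure lebesgue S"
      using measure_stretch[OF lmeasurable_compact[OF S], of c] by simp
  next
    fix m n :: 'm and S :: "(real^'m) set" assume S: "compact S"
    let ?\<tau> = "Transposition.transpose m n"
    let ?h = "\<lambda>x::real^'m. \<chi> i. x $ ?\<tau> i"
    have lin: "linear ?h" by (rule linearI) (simp_all add: vec_eq_iff)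
    have invol: "?h \<circ> ?h = id" by (simp add: fun_eq_iff vec_eq_iff)
    have "matrix ?h ** matrix ?h = mat 1"
      using matrix_compose[OF lin lin] by (simp only: invol matrix_id_mat_1)
    then have "det (matrix ?h) * det (matrix ?h) = 1" by (simp only: det_I flip: det_mul)
    then have "\<bar>det (matrix ?h)\<bar> = 1" by (auto simp: square_eq_1_iff)
    moreover have "distr lborel borel ?h = lborel"
    proof -
      have m: "(\<lambda>c. \<chi> j. c (id j)) \<in> borel_measurable ?M"
        by (rule borel_measurable_vec_PiM) simp
      have mh: "?h \<in> borel_measurable borel"
        using lin by (intro borel_measurable_continuous_onI linear_continuous_on) (auto simp: linear_conv_bounded_linear)
      have "distr lborel borel ?h = distr (distr ?M borel (\<lambda>c. \<chi> j. c (id j))) borel ?h"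
        using lborel_eq_distr_PiM[OF bij_id[where 'a='m]] by simp
      also have "\<dots> = distr ?M borel (\<lambda>c. \<chi> j. c (?\<tau> j))"
        using m mh by (subst distr_distr) (simp_all add: comp_def)
      also have "\<dots> = lborel"
        by (rule lborel_eq_distr_PiM[symmetric]) simp
      finally show ?thesis .
    qed
    ultimately show "measure lebesgue (?h ` S) = \<bar>det (matrix ?h)\<bar> * measure lebesgue S"
      using preserve[OF lin _ _ S] inj_on_inverseI[of UNIV ?h ?h] by (simp add: vec_eq_iff)
  next
    fix m n :: 'm and S :: "(real^'m) set" assume mn: "m \<noteq> n" and S: "compact S"
    let ?h = "\<lambda>x::real^'m. \<chi> i. if i = m then x $ m + x $ n else x $ i"
    have lin: "linear ?h" by (rule linearI) (auto simp: vec_eq_iff algebra_simps)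
    have "matrix ?h = (\<chi> k. if k = m then row m (mat 1) + 1 *s row n (mat 1) else row k (mat 1))"
      by (auto simp: vec_eq_iff matrix_def row_def mat_def axis_def)
    then have "det (matrix ?h) = 1"
      using det_row_operation[OF mn, of "mat 1 :: real^'m^'m" 1] by (simp only: det_I)
    moreover have "inj ?h"
    proof (rule injI)
      fix x y assume eq: "?h x = ?h y"
      have "x $ i = y $ i" if "i \<noteq> m" for i
        using arg_cong[OF eq, of "\<lambda>v. v $ i"] that by simp
      moreover from this[of n] have "x $ m = y $ m"
        using arg_cong[OF eq, of "\<lambda>v. v $ m"] mn by simp
      ultimately show "x = y" by (metis vec_eq_iff)
    qed
    moreover have "distr lborel borel ?h = lborel"
    proof (rule measure_eqI)
      interpret product_sigma_finite "\<lambda>_. lborel :: real measure" by standard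
      have m[measurable]: "vec_lambda \<in> borel_measurable ?M"
        using borel_measurable_vec_PiM[of "\<lambda>j::'m. j" UNIV] by simp
      have mh[measurable]: "?h \<in> borel_measurable borel"
        using lin by (intro borel_measurable_continuous_onI linear_continuous_on) (auto simp: linear_conv_bounded_linear)
      have leb: "lborel = distr ?M borel (vec_lambda :: _ \<Rightarrow> real^'m)"
        using lborel_eq_distr_PiM[OF bij_id[where 'a='m]] by simp
      let ?I = "UNIV - {m}"
      have ins: "insert m ?I = UNIV" by auto
      \<comment> \<open>The coordinate \<open>m\<close>, which the shear translates by \<open>x $ n\<close>, is integrated first.\<close>
      have fubini: "(\<integral>\<^sup>+x. g x \<partial>lborel) = (\<integral>\<^sup>+c. (\<integral>\<^sup>+y. g (vec_lambda (c(m := y))) \<partial>lborel) \<partial>Pi\<^sub>M ?I (\<lambda>_. lborel))"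
        if g[measurable]: "g \<in> borel_measurable borel" for g :: "real^'m \<Rightarrow> ennreal"
      proof -
        have gm: "(\<lambda>c. g (vec_lambda c)) \<in> borel_measurable ?M" by measurable
        have "(\<integral>\<^sup>+x. g x \<partial>lborel) = (\<integral>\<^sup>+c. g (vec_lambda c) \<partial>?M)"
          by (subst leb, subst nn_integral_distr) auto
        also have "\<dots> = (\<integral>\<^sup>+c. (\<integral>\<^sup>+y. g (vec_lambda (c(m := y))) \<partial>lborel) \<partial>Pi\<^sub>M ?I (\<lambda>_. lborel))"
          using product_nn_integral_insert[of ?I m "\<lambda>c. g (vec_lambda c)"] gm unfolding ins by simp
        finally show ?thesis .
      qed
      fix X assume "X \<in> sets (distr lborel borel ?h)"
      then have X[measurable]: "X \<in> sets borel" by simp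
      have "emeasure (distr lborel borel ?h) X = (\<integral>\<^sup>+x. indicator X x \<partial>distr lborel borel ?h)"
        using X by simp
      also have "\<dots> = (\<integral>\<^sup>+x. indicator X (?h x) \<partial>lborel)"
        using X mh by (intro nn_integral_distr) simp_all
      also have "\<dots> = (\<integral>\<^sup>+c. (\<integral>\<^sup>+y. indicator X (?h (vec_lambda (c(m := y)))) \<partial>lborel) \<partial>Pi\<^sub>M ?I (\<lambda>_. lborel))"
        by (rule fubini) measurable
      also have "\<dots> = (\<integral>\<^sup>+c. (\<integral>\<^sup>+y. indicator X (vec_lambda (c(m := y))) \<partial>lborel) \<partial>Pi\<^sub>M ?I (\<lambda>_. lborel))"
      proof (rule nn_integral_cong)
        fix c :: "'m \<Rightarrow> real" assume "c \<in> space (Pi\<^sub>M ?I (\<lambda>_. lborel))"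
        have line: "(\<lambda>y. vec_lambda (c(m := y)) :: real^'m) \<in> borel_measurable borel"
        proof -
          have "continuous_on UNIV (\<lambda>y. (c(m := y)) i)" for i
            by (cases "i = m") simp_all
          then have "continuous_on UNIV (\<lambda>y. \<chi> i. (c(m := y)) i)"
            by (rule continuous_on_vec_lambda)
          then show ?thesis by (rule borel_measurable_continuous_onI)
        qed
        have step: "?h (vec_lambda (c(m := y))) = vec_lambda (c(m := c n + y))" for y
          using mn by (simp add: vec_eq_iff)
        have "(\<integral>\<^sup>+y. indicator X (vec_lambda (c(m := y))) \<partial>lborel)
            = (\<integral>\<^sup>+y. indicator X (vec_lambda (c(m := y))) \<partial>distr lborel borel ((+) (c n)))"
          by (simp add: lborel_distr_plus)
        also have "\<dots> = (\<integral>\<^sup>+y. indicator X (vec_lambda (c(m := c n + y))) \<partial>lborel)"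
          using measurable_compose[OF line borel_measurable_indicator[OF X]] by (subst nn_integral_distr) simp_all
        finally show "(\<integral>\<^sup>+y. indicator X (?h (vec_lambda (c(m := y)))) \<partial>lborel)
            = (\<integral>\<^sup>+y. indicator X (vec_lambda (c(m := y))) \<partial>lborel)"
          unfolding step by simp
      qed
      also have "\<dots> = (\<integral>\<^sup>+x. indicator X x \<partial>lborel)"
        by (rule fubini[symmetric]) measurable
      also have "\<dots> = emeasure lborel X" by simp
      finally show "emeasure (distr lborel borel ?h) X = emeasure lborel X" .
    qed simp
    ultimately show "measure lebesgue (?h ` S) = \<bar>det (matrix ?h)\<bar> * measure lebesgue S"
      using preserve[OF lin _ _ S] by simp
  qed
  then show ?thesis using assms(2) by blast
qed

lemma matrix_mult_transpose_inner:
  fixes A :: "real^'m^'n"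
  shows "(transpose A ** A) $ i $ j = (A *v axis i 1) \<bullet> (A *v axis j 1)"
  by (simp add: matrix_vector_mult_basis matrix_matrix_mult_def transpose_def column_def inner_vec_def)

text \<open>
  In the coordinates of an orthonormal chart \<open>A\<close> becomes a square matrix \<open>B\<close>.  Since the chart is
  isometric, \<open>B\<close> has the same Gram matrix as \<open>A\<close>, whose determinant is the square of \<open>det B\<close>.
\<close>

lemma chart_measure_affine_image:
  fixes A :: "real^'m^'n" and S :: "(real^'m) set"
  assumes o: "orthonormal CARD('m) b" and S: "compact S"
    and r: "range (\<lambda>s. x\<^sub>0 + A *v s) \<subseteq> range (flat_map CARD('m) p b)"
  shows "chart_measure CARD('m) p b ((\<lambda>s. x\<^sub>0 + A *v s) ` S)
       = sqrt (det (transpose A ** A)) * measure lebesgue S"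
proof -
  obtain e where e: "bij_betw e (UNIV :: 'm set) {..<CARD('m)}"
    using ex_bij_betw_finite_nat[of "UNIV :: 'm set"] by (auto simp: lessThan_atLeast0)
  have ej: "e j < CARD('m)" for j using e by (auto simp: bij_betw_def)
  let ?M = "\<Pi>\<^sub>M i\<in>{..<CARD('m)}. (lborel :: real measure)"
  define V :: "(nat \<Rightarrow> real) \<Rightarrow> real^'m" where "V = (\<lambda>c. \<chi> j. c (e j))"
  define B :: "real^'m^'m" where "B = matrix (\<lambda>s. \<chi> j. b (e j) \<bullet> (A *v s))"
  define t :: "real^'m" where "t = (\<chi> j. b (e j) \<bullet> (x\<^sub>0 - p))"
  have lin: "linear (\<lambda>s. (\<chi> j. b (e j) \<bullet> (A *v s)) :: real^'m)"
    by (rule linearI) (simp_all add: vec_eq_iff matrix_vector_right_distrib inner_add_right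
        matrix_vector_mult_scaleR)
  have Bv: "B *v s = (\<chi> j. b (e j) \<bullet> (A *v s))" for s
    unfolding B_def using fun_cong[OF matrix_vector_mul(2)[OF lin], of s] by simp
  have iff: "flat_map CARD('m) p b c = x\<^sub>0 + A *v s \<longleftrightarrow> V c = t + B *v s" for c s
  proof -
    have "flat_map CARD('m) p b c = x\<^sub>0 + A *v s \<longleftrightarrow> (\<forall>i<CARD('m). c i = b i \<bullet> (x\<^sub>0 + A *v s - p))"
      using r by (intro flat_map_eq_iff[OF o]) auto
    also have "\<dots> \<longleftrightarrow> (\<forall>j. c (e j) = b (e j) \<bullet> (x\<^sub>0 + A *v s - p))"
      using e ej by (metis (no_types, lifting) bij_betw_def imageE lessThan_iff)
    also have "\<dots> \<longleftrightarrow> V c = t + B *v s"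
      by (simp add: vec_eq_iff V_def t_def Bv algebra_simps)
    finally show ?thesis .
  qed
  \<comment> \<open>Parseval's identity for the orthonormal basis \<open>b\<close> of a space that contains the range of \<open>A\<close>.\<close>
  have inner: "(A *v s) \<bullet> (A *v s') = (B *v s) \<bullet> (B *v s')" for s s'
  proof -
    let ?c = "\<lambda>s i. b i \<bullet> (x\<^sub>0 + A *v s - p)"
    have rep: "flat_map CARD('m) p b (?c s) = x\<^sub>0 + A *v s" for s
      using r by (subst flat_map_eq_iff[OF o]) auto
    have expand: "A *v s = (\<Sum>i<CARD('m). (b i \<bullet> (A *v s)) *\<^sub>R b i)" for s
    proof -
      have "A *v s = flat_map CARD('m) p b (?c s) - flat_map CARD('m) p b (?c 0)"
        by (simp only: rep) simp
      also have "\<dots> = (\<Sum>i<CARD('m). (b i \<bullet> (A *v s)) *\<^sub>R b i)"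
        by (simp add: flat_map_def inner_diff_right inner_add_right scaleR_diff_left scaleR_add_left
            sum_subtractf sum.distrib)
      finally show ?thesis .
    qed
    have "(A *v s) \<bullet> (A *v s') = (\<Sum>i<CARD('m). (b i \<bullet> (A *v s)) *\<^sub>R b i) \<bullet> (A *v s')"
      using expand[of s] by simp
    also have "\<dots> = (\<Sum>i<CARD('m). (b i \<bullet> (A *v s)) * (b i \<bullet> (A *v s')))"
      by (simp add: inner_sum_left)
    also have "\<dots> = (\<Sum>j\<in>UNIV. (b (e j) \<bullet> (A *v s)) * (b (e j) \<bullet> (A *v s')))"
      using sum.reindex_bij_betw[OF e, of "\<lambda>i. (b i \<bullet> (A *v s)) * (b i \<bullet> (A *v s'))"] by simp
    also have "\<dots> = (B *v s) \<bullet> (B *v s')"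
      by (simp add: inner_vec_def Bv)
    finally show ?thesis .
  qed
  have "transpose A ** A = transpose B ** B"
    by (simp add: vec_eq_iff matrix_mult_transpose_inner inner)
  then have "det (transpose A ** A) = (det B)\<^sup>2"
    by (simp add: det_mul det_transpose power2_eq_square)
  then have d: "sqrt (det (transpose A ** A)) = \<bar>det B\<bar>" by simp

  let ?T = "(+) t ` (*v) B ` S"
  have cT: "compact ?T"
    using S by (intro compact_translation compact_continuous_image matrix_vector_mult_linear_continuous_on)
  have "V \<in> borel_measurable ?M"
    unfolding V_def using ej by (intro borel_measurable_vec_PiM) simp
  have "{c \<in> space ?M. flat_map CARD('m) p b c \<in> (\<lambda>s. x\<^sub>0 + A *v s) ` S} = V -` ?T \<inter> space ?M"
    using iff by (auto simp: image_iff)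
  then have "chart_measure CARD('m) p b ((\<lambda>s. x\<^sub>0 + A *v s) ` S) = measure ?M (V -` ?T \<inter> space ?M)"
    by (simp add: chart_measure_def)
  also have "\<dots> = measure (distr ?M borel V) ?T"
    using \<open>V \<in> borel_measurable ?M\<close> cT by (subst measure_distr) (auto intro: borel_compact)
  also have "distr ?M borel V = lborel"
    unfolding V_def by (rule lborel_eq_distr_PiM[OF e, symmetric])
  also have "measure lborel ?T = measure lebesgue ?T"
    using cT by (simp add: measure_completion borel_compact)
  also have "\<dots> = measure lebesgue ((*v) B ` S)"
    by (rule measure_translation)
  also have "\<dots> = \<bar>det B\<bar> * measure lebesgue S"
    using measure_linear_image_cart[of "(*v) B" S] S by simp
  finally show ?thesis by (simp add: d)
qed

section \<open>Crossing a face\<close>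

text \<open>
  Near \<open>x\<close> the boundary of \<open>S\<close> lies in the hyperplane through \<open>x\<close> orthogonal to \<open>n\<close>, so each of the
  two open half balls is connected and misses the boundary.  The points on the line through \<open>x\<close> in
  direction \<open>n\<close> decide which half ball is inside \<open>S\<close>, and a direction \<open>w\<close> with \<open>n \<bullet> w > 0\<close> enters
  the same half balls as \<open>n\<close>.
\<close>

lemma crosses_halfspaces:
  fixes S F :: "'a::euclidean_space set"
  assumes F: "\<And>y. y \<in> F \<Longrightarrow> n \<bullet> (y - x) = 0" and x: "x \<notin> closure (frontier S - F)"
    and n: "\<exists>e>0. \<forall>t. 0 < t \<and> t < e \<longrightarrow> x + t *\<^sub>R n \<notin> S \<and> x - t *\<^sub>R n \<in> S"
    and w: "n \<bullet> w > 0"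
  shows "\<exists>e>0. \<forall>t. 0 < t \<and> t < e \<longrightarrow> x + t *\<^sub>R w \<notin> S \<and> x - t *\<^sub>R w \<in> S"
proof -
  have "open (- closure (frontier S - F))" by (simp add: open_Compl)
  then obtain r where r: "r > 0" "ball x r \<subseteq> - closure (frontier S - F)"
    using x by (meson ComplI openE)
  obtain e where e: "e > 0" "\<And>t. 0 < t \<Longrightarrow> t < e \<Longrightarrow> x + t *\<^sub>R n \<notin> S \<and> x - t *\<^sub>R n \<in> S"
    using n by auto
  define U where "U = ball x r \<inter> {y. n \<bullet> y > n \<bullet> x}"
  define L where "L = ball x r \<inter> {y. n \<bullet> y < n \<bullet> x}"
  have conn: "connected U" "connected L"
    unfolding U_def L_def
    by (intro convex_connected convex_Int convex_ball convex_halfspace_gt convex_halfspace_lt)+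
  have "y \<notin> frontier S" if "y \<in> ball x r" "n \<bullet> y \<noteq> n \<bullet> x" for y
  proof
    assume "y \<in> frontier S"
    moreover have "y \<notin> F" using F[of y] that(2) by (auto simp: inner_diff_right)
    ultimately have "y \<in> closure (frontier S - F)"
      using closure_subset[of "frontier S - F"] by blast
    then show False using r(2) that(1) by blast
  qed
  then have front: "U \<inter> frontier S = {}" "L \<inter> frontier S = {}"
    by (auto simp: U_def L_def)
  have U: "x + t *\<^sub>R v \<in> U" and L: "x - t *\<^sub>R v \<in> L" if "0 < t" "t < r / (norm v + 1)" "n \<bullet> v > 0" for t v
  proof -
    have "t * (norm v + 1) < r" using that(2) by (simp add: pos_less_divide_eq add_nonneg_pos)
    moreover have "t * norm v \<le> t * (norm v + 1)" using that(1) by simp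
    ultimately have "t * norm v < r" by linarith
    then show "x + t *\<^sub>R v \<in> U" "x - t *\<^sub>R v \<in> L"
      using that by (auto simp: U_def L_def dist_norm inner_add_right inner_diff_right)
  qed
  have "n \<bullet> n > 0" using w by auto
  have "r / (norm n + 1) > 0" using r(1) by (simp add: add_nonneg_pos)
  then obtain t where t: "0 < t" "t < e" "t < r / (norm n + 1)"
    using e(1) dense[of 0 "min e (r / (norm n + 1))"] by auto
  have cross: "x + t *\<^sub>R n \<notin> S" "x - t *\<^sub>R n \<in> S" using e(2)[OF t(1,2)] by simp_all
  have "U \<inter> S = {}"
    using connected_Int_frontier[OF conn(1), of S] front(1) U[OF t(1,3) \<open>n \<bullet> n > 0\<close>] cross(1) by blast
  moreover have "L \<subseteq> S"
    using connected_Int_frontier[OF conn(2), of S] front(2) L[OF t(1,3) \<open>n \<bullet> n > 0\<close>] cross(2) by blast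
  ultimately have "x + t *\<^sub>R w \<notin> S \<and> x - t *\<^sub>R w \<in> S" if "0 < t" "t < r / (norm w + 1)" for t
    using U[OF that w] L[OF that w] by blast
  moreover have "r / (norm w + 1) > 0" using r(1) by (simp add: add_nonneg_pos)
  ultimately show ?thesis by blast
qed

section \<open>The Gram matrix\<close>

lemma inj_independent_columns:
  fixes A :: "real^'m^'n"
  assumes "independent_columns A"
  shows "inj ((*v) A)"
proof -
  have "v = 0" if "A *v v = 0" for v
  proof -
    have inj: "inj (\<lambda>j. column j A)" and ind: "independent (columns A)"
      using assms by (auto simp: independent_columns_def)
    have cols: "columns A = range (\<lambda>j. column j A)" by (auto simp: columns_def)
    define u where "u x = v $ (the_inv (\<lambda>j. column j A) x)" for x
    have u: "u (column j A) = v $ j" for j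
      unfolding u_def using the_inv_f_f[OF inj, of j] by simp
    have "(\<Sum>x\<in>columns A. u x *\<^sub>R x) = (\<Sum>j\<in>UNIV. u (column j A) *\<^sub>R column j A)"
      unfolding cols by (subst sum.reindex[OF inj]) simp
    also have "\<dots> = A *v v"
      by (simp add: u matrix_mult_sum scalar_mult_eq_scaleR)
    finally have "(\<Sum>x\<in>columns A. u x *\<^sub>R x) = 0" using that by simp
    then have "u x = 0" if "x \<in> columns A" for x
      using independentD[OF ind, of "columns A" u x] that by (simp add: cols)
    then have "v $ j = 0" for j using u[of j] cols by auto
    then show ?thesis by (simp add: vec_eq_iff)
  qed
  then show ?thesis
    using linear_injective_0[OF matrix_vector_mul_linear[of A]] by blast
qed

lemma inner_gram:
  fixes A :: "real^'m^'n"
  shows "(A *v u) \<bullet> (A *v v) = u \<bullet> ((transpose A ** A) *v v)"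
proof -
  have "(A *v u) \<bullet> (A *v v) = (u v* transpose A) \<bullet> (A *v v)"
    by (simp add: vector_transpose_matrix)
  also have "\<dots> = u \<bullet> ((transpose A ** A) *v v)"
    by (simp only: dot_lmul_matrix matrix_vector_mul_assoc)
  finally show ?thesis .
qed

lemma invertible_gram:
  fixes A :: "real^'m^'n"
  assumes "inj ((*v) A)"
  shows "invertible (transpose A ** A)"
proof -
  have "v = 0" if "(transpose A ** A) *v v = 0" for v
  proof -
    have "A *v v = 0" using inner_gram[of A v v] that by simp
    then show ?thesis using assms injD[OF assms, of v 0] by simp
  qed
  then have "inj ((*v) (transpose A ** A))"
    using linear_injective_0[OF matrix_vector_mul_linear[of "transpose A ** A"]] by blast
  then show ?thesis
    using matrix_left_invertible_injective invertible_left_inverse by blast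
qed

text \<open>
  This identity makes \<open>A G\<^bsup>-1\<^esup> n\<close>, with \<open>G\<close> the Gram matrix, the normal of the image of a hyperplane
  with normal \<open>n\<close>: its inner product with \<open>A u\<close> is that of \<open>n\<close> with \<open>u\<close>.
\<close>

lemma gram_inverse:
  fixes A :: "real^'m^'n"
  assumes "inj ((*v) A)"
  shows "(A *v u) \<bullet> (A *v (matrix_inv (transpose A ** A) *v n)) = u \<bullet> n"
proof -
  have "(transpose A ** A) ** matrix_inv (transpose A ** A) = mat 1"
    using invertible_gram[OF assms] unfolding invertible_def matrix_inv_def
    by (rule someI2_ex) simp
  then show ?thesis
    unfolding inner_gram by (simp only: matrix_vector_mul_assoc matrix_vector_mul_lid)
qed

section \<open>Faces and their images\<close>

lemma hyperplane_eq_translation: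
  fixes n :: "'a::real_inner"
  assumes "norm n = 1"
  shows "{s. n \<bullet> s = a} = (+) (a *\<^sub>R n) ` {s. n \<bullet> s = 0}"
proof (intro equalityI subsetI)
  fix s assume "s \<in> {s. n \<bullet> s = a}"
  then have "s - a *\<^sub>R n \<in> {s. n \<bullet> s = 0}" using assms by (simp add: inner_diff_right dot_square_norm)
  then have "a *\<^sub>R n + (s - a *\<^sub>R n) \<in> (+) (a *\<^sub>R n) ` {s. n \<bullet> s = 0}" by (rule imageI)
  then show "s \<in> (+) (a *\<^sub>R n) ` {s. n \<bullet> s = 0}" by simp
qed (use assms in \<open>auto simp: inner_add_right dot_square_norm\<close>)

lemma mem_prism_iff: "y \<in> prism v S \<longleftrightarrow> (\<exists>x\<in>S. \<exists>t\<in>{0..1}. y = x + t *\<^sub>R v)"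
  by (auto simp: prism_def)

text \<open>
  A chart of the hyperplane of \<open>F\<close>, extended by \<open>n\<close>, is a chart of the whole space, in which the
  prism has height 1.
\<close>

lemma measure_prism:
  fixes F :: "(real^'m) set"
  assumes F: "compact F" "affine hull F = {s. n \<bullet> s = a}" and n: "norm n = 1"
  shows "measure lebesgue (prism n F) = flat_measure (CARD('m) - 1) F"
proof -
  define k where "k = CARD('m) - 1"
  have k: "CARD('m) = Suc k" by (simp add: k_def)
  have nn: "n \<bullet> n = 1" "n \<noteq> 0" using n by (auto simp: dot_square_norm)
  define V where "V = {s. n \<bullet> s = 0}"
  have V: "subspace V" "dim V = k"
    using nn by (auto simp: V_def k_def subspace_hyperplane dim_hyperplane)
  have hull: "affine hull F = (+) (a *\<^sub>R n) ` V"
    unfolding F(2) V_def by (rule hyperplane_eq_translation[OF n])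
  obtain p b where b: "orthonormal k b" "range (flat_map k p b) = affine hull F"
      "\<And>i. i < k \<Longrightarrow> b i \<in> V" "flat_measure k F = chart_measure k p b F"
    by (rule flat_measure_chart[OF hull V]) (rule that)
  let ?b = "b(k := n)"
  have o: "orthonormal CARD('m) ?b"
    unfolding k using b by (intro orthonormal_Suc n) (auto simp: V_def inner_commute)
  have sp: "span (?b ` {..<CARD('m)}) = UNIV"
    by (rule orthonormal_spans[OF o]) auto
  have eq: "flat_map k p ?b = flat_map k p b" by (simp add: flat_map_def fun_eq_iff)
  have "chart_measure (Suc k) p ?b (prism n F) = 1 * chart_measure k p ?b F"
  proof (rule chart_measure_prism)
    show "orthonormal (Suc k) ?b" using o by (simp add: k)
    show "F \<subseteq> range (flat_map k p ?b)" unfolding eq b(2) by (rule hull_subset)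
    show "n \<in> span (?b ` {..<Suc k})" using sp by (simp add: k)
  qed (use F(1) nn in auto)
  moreover have "chart_measure CARD('m) p ?b ((\<lambda>s. 0 + mat 1 *v s) ` prism n F)
      = sqrt (det (transpose (mat 1) ** (mat 1 :: real^'m^'m))) * measure lebesgue (prism n F)"
    by (rule chart_measure_affine_image[OF o compact_prism[OF F(1)]])
       (simp add: range_flat_map[OF o, unfolded sp])
  ultimately show ?thesis
    by (simp add: k b(4) chart_measure_def eq)
qed

text \<open>
  Above a relative interior point of \<open>F\<close> the prism contains a ball, so its volume is positive.
\<close>

lemma flat_measure_face_pos:
  fixes F :: "(real^'m) set"
  assumes F: "compact F" "affine hull F = {s. n \<bullet> s = a}" and n: "norm n = 1"
    and x: "x \<in> rel_interior F"
  shows "flat_measure (CARD('m) - 1) F > 0"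
proof -
  have nn: "n \<bullet> n = 1" using n by (simp add: dot_square_norm)
  obtain e where e: "e > 0" "ball x e \<inter> affine hull F \<subseteq> F" and "x \<in> F"
    using x by (auto simp: mem_rel_interior_ball)
  have nx: "n \<bullet> x = a" using \<open>x \<in> F\<close> F(2) hull_subset[of F affine] by blast
  \<comment> \<open>Half of \<open>e\<close>, since a point at distance \<open>d\<close> from the centre has its foot on the hyperplane within
    \<open>2 * d\<close> of \<open>x\<close>; and \<open>1 / 2\<close> keeps the height between 0 and 1.\<close>
  define r where "r = min (e / 2) (1 / 2)"
  have r: "r > 0" "r \<le> e / 2" "r \<le> 1 / 2" using e(1) by (auto simp: r_def)
  have "ball (x + (1/2) *\<^sub>R n) r \<subseteq> prism n F"
  proof
    fix y assume "y \<in> ball (x + (1/2) *\<^sub>R n) r"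
    define u where "u = y - (x + (1/2) *\<^sub>R n)"
    have u: "norm u < r" using \<open>y \<in> _\<close> by (simp add: u_def dist_norm norm_minus_commute)
    have nu: "\<bar>n \<bullet> u\<bar> \<le> norm u" using Cauchy_Schwarz_ineq2[of n u] n by simp
    define z where "z = x + (u - (n \<bullet> u) *\<^sub>R n)"
    have "norm (u - (n \<bullet> u) *\<^sub>R n) \<le> norm u + norm ((n \<bullet> u) *\<^sub>R n)" by (rule norm_triangle_ineq4)
    also have "\<dots> < e" using u nu r n by simp
    finally have "z \<in> ball x e" by (simp add: z_def dist_norm norm_minus_commute)
    moreover have "z \<in> affine hull F"
      by (simp add: F(2) z_def inner_add_right inner_diff_right nn nx)
    ultimately have "z \<in> F" using e(2) by blast
    moreover have "y = z + (n \<bullet> u + 1/2) *\<^sub>R n" by (simp add: z_def u_def algebra_simps)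
    moreover have "n \<bullet> u + 1/2 \<in> {0..1}" using nu u r by auto
    ultimately show "y \<in> prism n F" unfolding prism_def by force
  qed
  then have "\<not> negligible (prism n F)"
    using open_not_negligible[OF open_ball, of "x + (1/2) *\<^sub>R n" r] r(1) negligible_subset by auto
  then have "measure lebesgue (prism n F) \<noteq> 0"
    using negligible_iff_measure0[OF lmeasurable_compact[OF compact_prism[OF F(1)]]] by blast
  then show ?thesis
    using measure_prism[OF F n] measure_nonneg[of lebesgue "prism n F"] by linarith
qed

text \<open>
  The volume of the image of the prism over \<open>F\<close> with edge \<open>n\<close> is computed twice: by the scaling law,
  and as the prism over the image of \<open>F\<close> with edge \<open>A n\<close>, whose height is \<open>1 / norm c\<close> for
  \<open>c = A G\<^bsup>-1\<^esup> n\<close>.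
\<close>

lemma flat_measure_face_image:
  fixes A :: "real^'m^'n" and F :: "(real^'m) set"
  assumes A: "inj ((*v) A)" and F: "compact F" "affine hull F = {s. n \<bullet> s = a}" and n: "norm n = 1"
  shows "flat_measure (CARD('m) - 1) ((\<lambda>s. x\<^sub>0 + A *v s) ` F)
    = sqrt (det (transpose A ** A)) * norm (A *v (matrix_inv (transpose A ** A) *v n))
      * flat_measure (CARD('m) - 1) F"
proof -
  define f where "f = (\<lambda>s. x\<^sub>0 + A *v s)"
  define k where "k = CARD('m) - 1"
  have k: "CARD('m) = Suc k" by (simp add: k_def)
  have nn: "n \<bullet> n = 1" "n \<noteq> 0" using n by (auto simp: dot_square_norm)
  define c where "c = A *v (matrix_inv (transpose A ** A) *v n)"
  have c: "(A *v u) \<bullet> c = u \<bullet> n" for u unfolding c_def by (rule gram_inverse[OF A])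
  have "norm c > 0" using c[of n] nn by auto
  have lin: "linear ((*v) A)" by (rule matrix_vector_mul_linear)
  define V where "V = {s. n \<bullet> s = 0}"
  have V: "subspace ((*v) A ` V)" "dim ((*v) A ` V) = k"
  proof -
    show "subspace ((*v) A ` V)"
      using linear_subspace_image[OF lin, of V] by (simp add: V_def subspace_hyperplane)
    show "dim ((*v) A ` V) = k"
      using dim_image_eq[OF lin, of V] nn A inj_on_subset[OF A]
      by (simp add: V_def k_def dim_hyperplane)
  qed
  have hull: "affine hull (f ` F) = (+) (f (a *\<^sub>R n)) ` (*v) A ` V"
  proof -
    have "f ` F = (+) x\<^sub>0 ` (*v) A ` F" by (simp add: f_def image_image)
    then have "affine hull (f ` F) = (+) x\<^sub>0 ` (*v) A ` (affine hull F)"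
      by (simp add: affine_hull_translation affine_hull_linear_image[symmetric])
    also have "affine hull F = (+) (a *\<^sub>R n) ` V"
      unfolding F(2) V_def by (rule hyperplane_eq_translation[OF n])
    also have "(+) x\<^sub>0 ` (*v) A ` (+) (a *\<^sub>R n) ` V = (+) (f (a *\<^sub>R n)) ` (*v) A ` V"
      by (simp add: f_def image_image matrix_vector_right_distrib add.assoc)
    finally show ?thesis .
  qed
  obtain p b where b: "orthonormal k b" "range (flat_map k p b) = affine hull (f ` F)"
      "\<And>i. i < k \<Longrightarrow> b i \<in> (*v) A ` V" "flat_measure k (f ` F) = chart_measure k p b (f ` F)"
    by (rule flat_measure_chart[OF hull V]) (rule that)
  define \<nu> where "\<nu> = (1 / norm c) *\<^sub>R c"
  let ?b = "b(k := \<nu>)"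
  have o: "orthonormal CARD('m) ?b"
    unfolding k
  proof (intro orthonormal_Suc b)
    show "norm \<nu> = 1" using \<open>norm c > 0\<close> by (simp add: \<nu>_def)
    show "b i \<bullet> \<nu> = 0" if i: "i < k" for i
    proof -
      obtain v where "v \<in> V" "b i = A *v v" using b(3)[OF i] by auto
      then show ?thesis using c[of v] by (simp add: \<nu>_def V_def inner_commute)
    qed
  qed
  have sp: "span (?b ` {..<CARD('m)}) = range ((*v) A)"
  proof (rule orthonormal_spans[OF o])
    show "subspace (range ((*v) A))" using linear_subspace_image[OF lin, of UNIV] by simp
    show "dim (range ((*v) A)) = CARD('m)"
      using dim_image_eq[OF lin, of UNIV] A by simp
    fix i assume i: "i < CARD('m)"
    have "\<nu> = A *v ((1 / norm c) *\<^sub>R (matrix_inv (transpose A ** A) *v n))"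
      by (simp add: \<nu>_def c_def matrix_vector_mult_scaleR)
    then have "\<nu> \<in> range ((*v) A)" by (rule range_eqI)
    then show "?b i \<in> range ((*v) A)" using b(3)[of i] i k by auto
  qed
  have eq: "flat_map k p ?b = flat_map k p b" by (simp add: flat_map_def fun_eq_iff)
  have cont: "continuous_on F f"
    unfolding f_def by (intro continuous_on_add continuous_on_const matrix_vector_mult_linear_continuous_on)
  have "chart_measure (Suc k) p ?b (prism (A *v n) (f ` F)) = (1 / norm c) * chart_measure k p ?b (f ` F)"
  proof (rule chart_measure_prism)
    show "orthonormal (Suc k) ?b" using o by (simp add: k)
    show "f ` F \<subseteq> range (flat_map k p ?b)" unfolding eq b(2) by (rule hull_subset)
    show "A *v n \<in> span (?b ` {..<Suc k})" using sp by (simp add: k)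
    show "compact (f ` F)" using compact_continuous_image[OF cont F(1)] .
    show "?b k \<bullet> (A *v n) = 1 / norm c"
      using c[of n] nn by (simp add: \<nu>_def inner_commute)
  qed (use \<open>norm c > 0\<close> in auto)
  moreover have "prism (A *v n) (f ` F) = f ` prism n F"
  proof -
    have f: "f (x + t *\<^sub>R n) = f x + t *\<^sub>R (A *v n)" for x t
      by (simp add: f_def matrix_vector_right_distrib matrix_vector_mult_scaleR)
    show ?thesis
    proof (intro equalityI subsetI)
      fix y assume "y \<in> prism (A *v n) (f ` F)"
      then obtain x t where x: "x \<in> F" "t \<in> {0..1}" "y = f x + t *\<^sub>R (A *v n)"
        by (auto simp: mem_prism_iff)
      then have "x + t *\<^sub>R n \<in> prism n F" unfolding mem_prism_iff by blast
      then show "y \<in> f ` prism n F" unfolding x(3) f[symmetric] by (rule imageI)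
    next
      fix y assume "y \<in> f ` prism n F"
      then obtain x t where "x \<in> F" "t \<in> {0..1}" "y = f (x + t *\<^sub>R n)"
        by (auto simp: mem_prism_iff)
      then show "y \<in> prism (A *v n) (f ` F)" unfolding mem_prism_iff f by blast
    qed
  qed
  moreover have "chart_measure CARD('m) p ?b (f ` prism n F)
      = sqrt (det (transpose A ** A)) * measure lebesgue (prism n F)"
    unfolding f_def
  proof (rule chart_measure_affine_image[OF o compact_prism[OF F(1)]])
    have "flat_map k p b (\<lambda>_. 0) \<in> (+) (f (a *\<^sub>R n)) ` (*v) A ` V"
      unfolding hull[symmetric] b(2)[symmetric] by (rule rangeI)
    moreover have "flat_map k p b (\<lambda>_. 0) = p" by (simp add: flat_map_def)
    ultimately obtain v where "p = f (a *\<^sub>R n) + A *v v" by auto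
    then have v: "p = x\<^sub>0 + A *v (a *\<^sub>R n + v)"
      by (simp add: f_def matrix_vector_right_distrib)
    have "x\<^sub>0 + A *v s = p + A *v (s - (a *\<^sub>R n + v))" for s
      unfolding v by (simp add: matrix_vector_mult_diff_distrib)
    then show "range (\<lambda>s. x\<^sub>0 + A *v s) \<subseteq> range (flat_map CARD('m) p ?b)"
      unfolding range_flat_map[OF o] sp by blast
  qed
  moreover have "measure lebesgue (prism n F) = flat_measure k F"
    unfolding k_def by (rule measure_prism[OF F n])
  ultimately have "sqrt (det (transpose A ** A)) * flat_measure k F = flat_measure k (f ` F) / norm c"
    by (simp add: k b(4) chart_measure_def eq)
  then show ?thesis
    using \<open>norm c > 0\<close> unfolding f_def[symmetric] k_def[symmetric] c_def[symmetric]
    by (simp add: field_simps)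
qed

lemma flat_measure_affine_image:
  fixes A :: "real^'m^'n" and S :: "(real^'m) set"
  assumes A: "inj ((*v) A)" and S: "compact S" "affine hull S = UNIV"
  shows "flat_measure CARD('m) ((\<lambda>s. x\<^sub>0 + A *v s) ` S)
       = sqrt (det (transpose A ** A)) * measure lebesgue S"
proof -
  let ?f = "\<lambda>s. x\<^sub>0 + A *v s"
  have lin: "linear ((*v) A)" by (rule matrix_vector_mul_linear)
  have "?f ` S = (+) x\<^sub>0 ` (*v) A ` S" by (simp add: image_image)
  then have hull: "affine hull (?f ` S) = (+) x\<^sub>0 ` range ((*v) A)"
    by (simp add: affine_hull_translation affine_hull_linear_image[symmetric] S(2))
  have V: "subspace (range ((*v) A))" "dim (range ((*v) A)) = CARD('m)"
    using linear_subspace_image[OF lin, of UNIV] dim_image_eq[OF lin, of UNIV] A by simp_all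
  obtain p b where "orthonormal CARD('m) b" "range (flat_map CARD('m) p b) = affine hull (?f ` S)"
      "flat_measure CARD('m) (?f ` S) = chart_measure CARD('m) p b (?f ` S)"
    by (rule flat_measure_chart[OF hull V]) (rule that)
  then show ?thesis
    using chart_measure_affine_image[of b S x\<^sub>0 A p] S(1) hull by (simp add: image_image)
qed

lemma affine_hull_flat_face:
  fixes F :: "'a::euclidean_space set"
  assumes F: "flat_face F S" and n: "n \<noteq> 0" "\<And>y. y \<in> F \<Longrightarrow> orthogonal n (x - y)" and x: "x \<in> F"
  shows "affine hull F = {s. n \<bullet> s = n \<bullet> x}"
proof (rule affine_dim_equal)
  have "F \<subseteq> {s. n \<bullet> s = n \<bullet> x}"
    using n(2) by (auto simp: orthogonal_def inner_diff_right)
  then show "affine hull F \<subseteq> {s. n \<bullet> s = n \<bullet> x}"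
    by (intro hull_minimal affine_hyperplane)
qed (use F n x in \<open>auto simp: flat_face_def affine_hyperplane\<close>)

text \<open>
  Injective affine maps carry relative interiors, relative boundaries and closures to those of the
  image, so the crossing condition can be tested in the parameter space, in the direction
  \<open>w = G\<^bsup>-1\<^esup> n\<close>; it makes an acute angle with \<open>n\<close> because \<open>n \<bullet> w = A w \<bullet> A w\<close>.
\<close>

lemma outward_normal_affine_image:
  fixes A :: "real^'m^'n" and S F :: "(real^'m) set" and x\<^sub>0 :: "real^'n"
  assumes A: "inj ((*v) A)" and S: "interior S \<noteq> {}" and F: "flat_face F S"
    and n: "norm n = 1" "outward_normal S F n" and "\<kappa> > 0"
  defines "f \<equiv> \<lambda>s. x\<^sub>0 + A *v s" and "w \<equiv> matrix_inv (transpose A ** A) *v n"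
  shows "outward_normal (f ` S) (f ` F) (\<kappa> *\<^sub>R (A *v w))"
proof -
  have adj: "(A *v u) \<bullet> (A *v w) = u \<bullet> n" for u
    unfolding w_def by (rule gram_inverse[OF A])
  have orth: "orthogonal n (x - y)" if "x \<in> F" "y \<in> F" for x y
    using n(2) that by (simp add: outward_normal_def)
  have lin: "linear ((*v) A)" by (rule matrix_vector_mul_linear)
  have fim: "f ` T = (+) x\<^sub>0 ` (*v) A ` T" for T by (simp add: f_def image_image)
  have injf: "inj f" using A by (auto simp: inj_def f_def)
  have ri: "rel_interior (f ` T) = f ` rel_interior T" for T
    unfolding fim rel_interior_translation
    using rel_interior_injective_linear_image[OF matrix_vector_mul_bounded_linear A] by simp
  have cl: "closure (f ` T) = f ` closure T" for T
    unfolding fim closure_translation closure_injective_linear_image[OF lin A, symmetric] ..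
  have rf: "rel_frontier (f ` S) = f ` frontier S"
    unfolding rel_frontier_def ri cl image_set_diff[OF injf, symmetric]
    using rel_frontier_nonempty_interior[OF S] by (simp add: rel_frontier_def)
  show ?thesis
    unfolding outward_normal_def
  proof (intro conjI ballI)
    fix x' y' assume "x' \<in> f ` F" "y' \<in> f ` F"
    then obtain x y where xy: "x \<in> F" "y \<in> F" "x' = f x" "y' = f y" by blast
    have "x' - y' = A *v (x - y)"
      by (simp add: xy(3,4) f_def matrix_vector_mult_diff_distrib)
    then show "orthogonal (\<kappa> *\<^sub>R (A *v w)) (x' - y')"
      using adj[of "x - y"] orth[OF xy(1,2)] by (simp add: orthogonal_def inner_commute)
  next
    fix x' assume "x' \<in> rel_interior (f ` F) - closure (rel_frontier (f ` S) - f ` F)"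
    then have "x' \<in> f ` (rel_interior F - closure (frontier S - F))"
      by (simp only: ri rf cl image_set_diff[OF injf, symmetric])
    then obtain x where x: "x' = f x" "x \<in> rel_interior F" "x \<notin> closure (frontier S - F)" by blast
    have "x \<in> F" using x(2) rel_interior_subset by blast
    have "\<exists>e>0. \<forall>t. 0 < t \<and> t < e \<longrightarrow> x + t *\<^sub>R (\<kappa> *\<^sub>R w) \<notin> S \<and> x - t *\<^sub>R (\<kappa> *\<^sub>R w) \<in> S"
    proof (rule crosses_halfspaces)
      show "n \<bullet> (y - x) = 0" if "y \<in> F" for y
        using orth[OF that \<open>x \<in> F\<close>] by (simp add: orthogonal_def)
      show "x \<notin> closure (frontier S - F)" by (rule x(3))
      show "\<exists>e>0. \<forall>t. 0 < t \<and> t < e \<longrightarrow> x + t *\<^sub>R n \<notin> S \<and> x - t *\<^sub>R n \<in> S"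
        using n(2) x(2,3) rel_frontier_nonempty_interior[OF S] by (simp add: outward_normal_def)
      have "A *v w \<noteq> 0" using adj[of n] n(1) by (auto simp: dot_square_norm)
      then have "n \<bullet> w > 0" using adj[of w] by (metis inner_commute inner_gt_zero_iff)
      then show "n \<bullet> (\<kappa> *\<^sub>R w) > 0" using \<open>\<kappa> > 0\<close> by simp
    qed
    moreover have "f (x + t *\<^sub>R (\<kappa> *\<^sub>R w)) = x' + t *\<^sub>R (\<kappa> *\<^sub>R (A *v w))"
        "f (x - t *\<^sub>R (\<kappa> *\<^sub>R w)) = x' - t *\<^sub>R (\<kappa> *\<^sub>R (A *v w))" for t
      by (simp_all add: x(1) f_def matrix_vector_right_distrib matrix_vector_mult_diff_distrib
          matrix_vector_mult_scaleR)
    moreover have "f y \<in> f ` S \<longleftrightarrow> y \<in> S" for y using injf by (rule inj_image_mem_iff)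
    ultimately show "\<exists>e>0. \<forall>t. 0 < t \<and> t < e \<longrightarrow>
        x' + t *\<^sub>R (\<kappa> *\<^sub>R (A *v w)) \<notin> f ` S \<and> x' - t *\<^sub>R (\<kappa> *\<^sub>R (A *v w)) \<in> f ` S"
      by metis
  qed
qed

theorem theorem6p1:
  fixes \<Sigma>\<^sub>s :: "(real^'m) set" and A :: "real^'m^'n" and x\<^sub>0 :: "real^'n"
    and \<Sigma> :: "(real^'n) set"
  assumes "1 \<le> CARD('m)" and "CARD('m) \<le> CARD('n)"
    and "flat_faced_polytope \<Sigma>\<^sub>s"
    and "independent_columns A"
    and "\<Sigma> = (\<lambda>s. x\<^sub>0 + A *v s) ` \<Sigma>\<^sub>s"
  shows "flat_measure CARD('m) \<Sigma> / measure lebesgue \<Sigma>\<^sub>s = sqrt (det (transpose A ** A)) \<and>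
    (\<forall>\<sigma>\<^sub>s n\<^sub>s \<sigma> n\<^sub>x.
       flat_face \<sigma>\<^sub>s \<Sigma>\<^sub>s \<and> norm n\<^sub>s = 1 \<and> outward_normal \<Sigma>\<^sub>s \<sigma>\<^sub>s n\<^sub>s \<and>
       \<sigma> = (\<lambda>s. x\<^sub>0 + A *v s) ` \<sigma>\<^sub>s \<and>
       n\<^sub>x = (flat_measure (CARD('m) - 1) \<sigma>\<^sub>s / flat_measure (CARD('m) - 1) \<sigma>
              * (flat_measure CARD('m) \<Sigma> / measure lebesgue \<Sigma>\<^sub>s))
             *\<^sub>R (A *v (matrix_inv (transpose A ** A) *v n\<^sub>s))
       \<longrightarrow> norm n\<^sub>x = 1 \<and> n\<^sub>x \<in> range ((*v) A) \<and> outward_normal \<Sigma> \<sigma> n\<^sub>x)"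
proof (intro conjI allI impI)
  have A: "inj ((*v) A)" using assms(4) by (rule inj_independent_columns)
  have S: "compact \<Sigma>\<^sub>s" "interior \<Sigma>\<^sub>s \<noteq> {}"
    using assms(3) by (auto simp: flat_faced_polytope_def)
  define g where "g = sqrt (det (transpose A ** A))"
  have "flat_measure CARD('m) \<Sigma> = g * measure lebesgue \<Sigma>\<^sub>s"
    unfolding assms(5) g_def
    by (rule flat_measure_affine_image[OF A S(1) affine_hull_nonempty_interior[OF S(2)]])
  moreover have pos: "measure lebesgue \<Sigma>\<^sub>s > 0"
  proof -
    have "\<not> negligible \<Sigma>\<^sub>s"
      using open_not_negligible[OF open_interior S(2)] negligible_subset interior_subset by blast
    then have "measure lebesgue \<Sigma>\<^sub>s \<noteq> 0"
      using negligible_iff_measure0[OF lmeasurable_compact[OF S(1)]] by blast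
    then show ?thesis using measure_nonneg[of lebesgue \<Sigma>\<^sub>s] by linarith
  qed
  ultimately have ratio: "flat_measure CARD('m) \<Sigma> / measure lebesgue \<Sigma>\<^sub>s = g" by simp
  then show "flat_measure CARD('m) \<Sigma> / measure lebesgue \<Sigma>\<^sub>s = sqrt (det (transpose A ** A))"
    by (simp add: g_def)
  \<comment> \<open>\<open>g\<close> is a ratio of measures, which rules out a negative determinant.\<close>
  have "g \<ge> 0"
    unfolding ratio[symmetric] by (simp add: flat_measure_def Let_def split: prod.splits)
  moreover have "g \<noteq> 0"
    using invertible_gram[OF A] by (simp add: g_def invertible_det_nz)
  ultimately have "g > 0" by simp

  fix \<sigma>\<^sub>s n\<^sub>s \<sigma> n\<^sub>x
  assume asm: "flat_face \<sigma>\<^sub>s \<Sigma>\<^sub>s \<and> norm n\<^sub>s = 1 \<and> outward_normal \<Sigma>\<^sub>s \<sigma>\<^sub>s n\<^sub>s \<and>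
       \<sigma> = (\<lambda>s. x\<^sub>0 + A *v s) ` \<sigma>\<^sub>s \<and>
       n\<^sub>x = (flat_measure (CARD('m) - 1) \<sigma>\<^sub>s / flat_measure (CARD('m) - 1) \<sigma>
              * (flat_measure CARD('m) \<Sigma> / measure lebesgue \<Sigma>\<^sub>s))
             *\<^sub>R (A *v (matrix_inv (transpose A ** A) *v n\<^sub>s))"
  then have face: "flat_face \<sigma>\<^sub>s \<Sigma>\<^sub>s" and n: "norm n\<^sub>s = 1" and out: "outward_normal \<Sigma>\<^sub>s \<sigma>\<^sub>s n\<^sub>s"
    and \<sigma>: "\<sigma> = (\<lambda>s. x\<^sub>0 + A *v s) ` \<sigma>\<^sub>s" by auto
  define c where "c = A *v (matrix_inv (transpose A ** A) *v n\<^sub>s)"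
  define \<kappa> where "\<kappa> = flat_measure (CARD('m) - 1) \<sigma>\<^sub>s / flat_measure (CARD('m) - 1) \<sigma> * g"
  have nx: "n\<^sub>x = \<kappa> *\<^sub>R c" using asm by (simp add: \<kappa>_def c_def ratio)
  have comp: "compact \<sigma>\<^sub>s" using face by (simp add: flat_face_def)
  have "\<sigma>\<^sub>s \<noteq> {}" using face by (auto simp: flat_face_def)
  moreover have "closure (rel_interior \<sigma>\<^sub>s) = \<sigma>\<^sub>s" using face by (simp add: flat_face_def)
  ultimately have "rel_interior \<sigma>\<^sub>s \<noteq> {}" by (metis closure_empty)
  then obtain x where x: "x \<in> rel_interior \<sigma>\<^sub>s" by blast
  then have "x \<in> \<sigma>\<^sub>s" using rel_interior_subset by blast
  have hull: "affine hull \<sigma>\<^sub>s = {s. n\<^sub>s \<bullet> s = n\<^sub>s \<bullet> x}"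
    by (rule affine_hull_flat_face[OF face])
       (use n out \<open>x \<in> \<sigma>\<^sub>s\<close> in \<open>auto simp: outward_normal_def\<close>)
  have "(A *v n\<^sub>s) \<bullet> c = 1" unfolding c_def using gram_inverse[OF A, of n\<^sub>s n\<^sub>s] n by (simp add: dot_square_norm)
  then have "norm c > 0" by auto
  have "flat_measure (CARD('m) - 1) \<sigma>\<^sub>s > 0"
    by (rule flat_measure_face_pos[OF comp hull n x])
  moreover have "flat_measure (CARD('m) - 1) \<sigma> = g * norm c * flat_measure (CARD('m) - 1) \<sigma>\<^sub>s"
    unfolding \<sigma> g_def c_def by (rule flat_measure_face_image[OF A comp hull n])
  ultimately have \<kappa>: "\<kappa> = 1 / norm c"
    using \<open>g > 0\<close> by (simp add: \<kappa>_def)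
  show "norm n\<^sub>x = 1" using \<open>norm c > 0\<close> by (simp add: nx \<kappa>)
  have "n\<^sub>x = A *v (\<kappa> *\<^sub>R (matrix_inv (transpose A ** A) *v n\<^sub>s))"
    by (simp add: nx c_def matrix_vector_mult_scaleR)
  then show "n\<^sub>x \<in> range ((*v) A)" by (rule range_eqI)
  show "outward_normal \<Sigma> \<sigma> n\<^sub>x"
    unfolding nx \<sigma> assms(5) c_def
    by (rule outward_normal_affine_image[OF A S(2) face n out]) (use \<kappa> \<open>norm c > 0\<close> in simp)
qed

end
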